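(* Let $k \ge 1$, $r = (r_1,\ldots,r_k) \in \mathbb{Z}_{\ge 0}^k$ and $w = (w_1,\ldots,w_k) \in \mathbb{Z}_{\ge 1}^k$ satisfy $r_1/w_1 \le \cdots \le r_k/w_k$ and $0 \le r_1 < w_1$. Let $W = \max_i w_i$, $R = \max_i r_i$, $p = w_1 r_k - w_k r_1$, and $P_n = \langle w_1 n + r_1, \ldots, w_k n + r_k\rangle$. For any integer $n > w_1^2 W R^2$, the image of any minimal presentation $\rho$ of $P_n$ under the map $\Phi_n : \ker \pi_n \to \ker \pi_{n+p}$ is a minimal presentation of $P_{n+p}$.
   Context: $\langle g_1,\ldots,g_k\rangle = \{\sum z_i g_i : z_i \in \mathbb{Z}_{\ge 0}\}$. The factorization homomorphism $\pi_n : \mathbb{Z}_{\ge 0}^k \to P_n$ is $\pi_n(z) = \sum_{i=1}^k z_i(w_i n + r_i)$, and $\ker\pi_n = \{(z,z') \in \mathbb{Z}_{\ge 0}^k\times\mathbb{Z}_{\ge 0}^k : \pi_n(z) = \pi_n(z')\}$. A congruence on $\mathbb{Z}_{\ge 0}^k$ is an equivalence relation closed under translation, i.e. containing $(z+u,z'+u)$ whenever it contains $(z,z')$ and $u \in \mathbb{Z}_{\ge 0}^k$; $\ker\pi_n$ is a congruence. A presentation of $P_n$ (with respect to the generators $w_1n+r_1,\ldots,w_kn+r_k$) is a subset $\rho \subset \ker\pi_n$ such that $\ker\pi_n$ is the smallest congruence on $\mathbb{Z}_{\ge 0}^k$ containing $\rho$; it is minimal if it is minimal with respect to containment among all presentations.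 Let $|z|_w = w_1 z_1 + \cdots + w_k z_k$ and let $e_i$ be the standard basis vectors. For $(z,z') \in \ker\pi_n$ put $\ell = \big||z|_w - |z'|_w\big|$ and define $\Phi_n(z,z')$ to be $(z + \ell w_k e_1,\ z' + \ell w_1 e_k)$ if $|z|_w > |z'|_w$; $(z + \ell w_1 e_k,\ z' + \ell w_k e_1)$ if $|z|_w < |z'|_w$; and $(z,z')$ if $|z|_w = |z'|_w$. The conditions on $r$ and $w$ in the claim are the paper's standing normalizations. *)

theory Defs
  imports "HOL-Analysis.Analysis"
begin

text \<open>
  Tuples of length \<open>k \<ge> 1\<close> are vectors indexed by a finite, nonempty, linearly ordered type
  \<open>'k\<close> with \<open>k = CARD('k)\<close>; the positions \<open>1\<close> and \<open>k\<close> are the least and the greatest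
  element of \<open>'k\<close>. The monoid of nonnegative integer vectors is the type \<open>nat ^ 'k\<close> with its
  componentwise addition, and the \<open>i\<close>-th standard basis vector is \<open>axis i 1\<close>.
\<close>

definition first_ix :: "'k::{finite,linorder}" where
  "first_ix = Min UNIV"

definition last_ix :: "'k::{finite,linorder}" where
  "last_ix = Max UNIV"


definition generated_monoid :: "nat ^ 'k \<Rightarrow> nat set" where
  "generated_monoid g = {\<Sum>i\<in>UNIV. z $ i * g $ i | z. True}"

definition factorization_hom :: "nat ^ 'k \<Rightarrow> nat ^ 'k \<Rightarrow> nat" where
  "factorization_hom g z = (\<Sum>i\<in>UNIV. z $ i * g $ i)"

definition factorization_kernel :: "nat ^ 'k \<Rightarrow> (nat ^ 'k) rel" where
  "factorization_kernel g = {(z, z'). factorization_hom g z = factorization_hom g z'}"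

definition is_congruence :: "(nat ^ 'k) rel \<Rightarrow> bool" where
  "is_congruence C \<longleftrightarrow> equiv UNIV C \<and> (\<forall>z z' u. (z, z') \<in> C \<longrightarrow> (z + u, z' + u) \<in> C)"

text \<open>
  Presentations of \<open>generated_monoid g\<close> are always relative to the tuple \<open>g\<close> of generators.
\<close>

definition is_presentation :: "nat ^ 'k \<Rightarrow> (nat ^ 'k) rel \<Rightarrow> bool" where
  "is_presentation g \<rho> \<longleftrightarrow>
     \<rho> \<subseteq> factorization_kernel g \<and> is_congruence hull \<rho> = factorization_kernel g"

definition is_minimal_presentation :: "nat ^ 'k \<Rightarrow> (nat ^ 'k) rel \<Rightarrow> bool" where
  "is_minimal_presentation g \<rho> \<longleftrightarrow>
     is_presentation g \<rho> \<and> (\<forall>\<sigma>. is_presentation g \<sigma> \<and> \<sigma> \<subseteq> \<rho> \<longrightarrow> \<sigma> = \<rho>)"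


definition shifted_gens :: "nat ^ 'k \<Rightarrow> nat ^ 'k \<Rightarrow> nat \<Rightarrow> nat ^ 'k" where
  "shifted_gens w r n = (\<chi> i. w $ i * n + r $ i)"

definition weight :: "nat ^ 'k \<Rightarrow> nat ^ 'k \<Rightarrow> nat" where
  "weight w z = (\<Sum>i\<in>UNIV. w $ i * z $ i)"

text \<open>
  The formula for \<open>\<Phi>\<^sub>n\<close> does not mention \<open>n\<close>, which only determines its domain, the kernel for
  \<open>shifted_gens w r n\<close>; so the map is defined here on all pairs.
\<close>

definition Phi :: "nat ^ 'k::{finite,linorder} \<Rightarrow>
    (nat ^ 'k::{finite,linorder}) \<times> (nat ^ 'k::{finite,linorder}) \<Rightarrow>
    (nat ^ 'k::{finite,linorder}) \<times> (nat ^ 'k::{finite,linorder})" where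
  "Phi w = (\<lambda>(z, z').
     let l = nat \<bar>int (weight w z) - int (weight w z')\<bar>;
         e1 = axis first_ix 1; ek = axis last_ix 1;
         w1 = w $ first_ix; wk = w $ last_ix
     in if weight w z > weight w z' then (z + (l * wk) *s e1, z' + (l * w1) *s ek)
        else if weight w z < weight w z' then (z + (l * w1) *s ek, z' + (l * wk) *s e1)
        else (z, z'))"

text \<open>
  The subtraction is the truncated one on \<open>nat\<close>; nothing is cut off when
  \<open>r\<^sub>1 / w\<^sub>1 \<le> r\<^sub>k / w\<^sub>k\<close>, see \<open>int_shift_period\<close>.
\<close>

definition shift_period :: "nat ^ 'k::{finite,linorder} \<Rightarrow> nat ^ 'k::{finite,linorder} \<Rightarrow> nat" where
  "shift_period w r = w $ first_ix * r $ last_ix - w $ last_ix * r $ first_ix"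


lemma first_ix_le_last_ix: "first_ix \<le> (last_ix :: 'k::{finite,linorder})"
  by (simp add: first_ix_def last_ix_def)

lemma range_factorization_hom: "range (factorization_hom g) = generated_monoid g"
  by (auto simp: generated_monoid_def factorization_hom_def)

lemma factorization_hom_add:
  "factorization_hom g (z + z') = factorization_hom g z + factorization_hom g z'"
  by (simp add: factorization_hom_def distrib_right sum.distrib)

lemma is_congruence_factorization_kernel: "is_congruence (factorization_kernel g)"
  unfolding is_congruence_def equiv_def refl_on_def sym_def trans_def
  by (simp add: factorization_kernel_def factorization_hom_add)

lemma is_congruence_hull: "is_congruence (is_congruence hull \<rho>)"
proof (rule hull_in)
  fix T :: "(nat ^ 'k) rel set"
  assume T: "Ball T is_congruence"
  have *: "refl C" "sym C" "trans C" "\<And>z z' u. (z, z') \<in> C \<Longrightarrow> (z + u, z' + u) \<in> C" if "C \<in> T" for C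
    using T that by (auto simp: is_congruence_def equiv_def)
  have "equiv UNIV (\<Inter>T)"
  proof (rule equivI)
    show "refl (\<Inter>T)"
      using *(1) by (simp add: refl_on_def)
    show "sym (\<Inter>T)"
      using *(2) by (simp add: sym_def)
    show "trans (\<Inter>T)"
      unfolding trans_def using transD[OF *(3)] by (meson InterE InterI)
  qed simp
  then show "is_congruence (\<Inter>T)"
    unfolding is_congruence_def using *(4) by simp
qed

lemma int_shift_period:
  fixes w r :: "nat ^ 'k::{finite,linorder}"
  assumes "\<forall>i. 1 \<le> w $ i"
    and "\<forall>i j. i \<le> j \<longrightarrow> real (r $ i) / real (w $ i) \<le> real (r $ j) / real (w $ j)"
  shows "int (shift_period w r)
    = int (w $ first_ix) * int (r $ last_ix) - int (w $ last_ix) * int (r $ first_ix)"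
proof -
  have pos: "real (w $ i) > 0" for i
    using assms(1)[rule_format, of i] by simp
  have "real (r $ first_ix) / real (w $ first_ix) \<le> real (r $ last_ix) / real (w $ last_ix)"
    using assms(2) first_ix_le_last_ix by blast
  then have "real (r $ first_ix) * real (w $ last_ix) \<le> real (r $ last_ix) * real (w $ first_ix)"
    using pos[of first_ix] pos[of last_ix] by (simp add: divide_simps split: if_splits)
  then have "w $ last_ix * r $ first_ix \<le> w $ first_ix * r $ last_ix"
    by (metis mult.commute of_nat_le_iff of_nat_mult)
  then show ?thesis
    by (simp add: shift_period_def of_nat_diff)
qed

lemma factorization_hom_axis: "factorization_hom g (c *s axis i 1) = c * g $ i"
proof -
  have "factorization_hom g (c *s axis i 1) = (\<Sum>j\<in>UNIV. if j = i then c * g $ j else 0)"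
    unfolding factorization_hom_def by (rule sum.cong) (auto simp: axis_def)
  then show ?thesis by simp
qed

lemma factorization_hom_shifted_gens:
  "factorization_hom (shifted_gens w r (n + p)) z
    = factorization_hom (shifted_gens w r n) z + p * weight w z"
  by (simp add: factorization_hom_def shifted_gens_def weight_def sum_distrib_left
      algebra_simps sum.distrib)

lemma Phi_in_factorization_kernel:
  fixes w r :: "nat ^ 'k::{finite,linorder}"
  assumes "\<forall>i. 1 \<le> w $ i"
    and "\<forall>i j. i \<le> j \<longrightarrow> real (r $ i) / real (w $ i) \<le> real (r $ j) / real (w $ j)"
    and "(z, z') \<in> factorization_kernel (shifted_gens w r n)"
  shows "Phi w (z, z') \<in> factorization_kernel (shifted_gens w r (n + shift_period w r))"
proof -
  define p where "p = shift_period w r"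
  define h where "h = factorization_hom (shifted_gens w r (n + p))"
  define w1 wk r1 rk where "w1 = int (w $ first_ix)" "wk = int (w $ last_ix)"
    "r1 = int (r $ first_ix)" "rk = int (r $ last_ix)"
  note d = this
  have p: "int p = w1 * rk - wk * r1"
    using int_shift_period[OF assms(1,2)] by (simp add: p_def d)
  have eq: "int (h z) - int (h z') = int p * (int (weight w z) - int (weight w z'))"
    using assms(3) unfolding h_def factorization_hom_shifted_gens
    by (simp add: factorization_kernel_def algebra_simps)
  have add: "int (h (u + (c * d) *s axis i 1))
      = int (h u) + int c * int d * (int (w $ i) * (int n + int p) + int (r $ i))" for u c d i
    unfolding h_def factorization_hom_add factorization_hom_axis
    by (simp add: shifted_gens_def algebra_simps)
  have "int (h (fst (Phi w (z, z')))) = int (h (snd (Phi w (z, z'))))"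
  proof (cases "weight w z" "weight w z'" rule: linorder_cases)
    case less
    define l where "l = nat \<bar>int (weight w z) - int (weight w z')\<bar>"
    have Phi: "Phi w (z, z') = (z + (l * w $ first_ix) *s axis last_ix 1,
        z' + (l * w $ last_ix) *s axis first_ix 1)"
      using less by (simp add: Phi_def l_def Let_def)
    have "int (h z) - int (h z') = - (int p * int l)"
      using less unfolding eq l_def by (simp add: algebra_simps)
    then show ?thesis
      unfolding Phi fst_conv snd_conv add d[symmetric] p by (simp add: algebra_simps)
  next
    case equal
    then show ?thesis using eq by (simp add: Phi_def)
  next
    case greater
    define l where "l = nat \<bar>int (weight w z) - int (weight w z')\<bar>"
    have Phi: "Phi w (z, z') = (z + (l * w $ last_ix) *s axis first_ix 1,
        z' + (l * w $ first_ix) *s axis last_ix 1)"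
      using greater by (simp add: Phi_def l_def Let_def)
    have "int (h z) - int (h z') = int p * int l"
      using greater unfolding eq l_def by (simp add: algebra_simps)
    then show ?thesis
      unfolding Phi fst_conv snd_conv add d[symmetric] p by (simp add: algebra_simps)
  qed
  then show ?thesis
    by (simp add: factorization_kernel_def h_def p_def case_prod_beta)
qed

end

theory Submission
  imports Defs
begin

text \<open>
  Write \<open>K n\<close> for the kernel of the generators \<open>w\<^sub>i n + r\<^sub>i\<close> and \<open>p\<close> for the period. Two
  factorizations lie in the same fibre of \<open>K n\<close> iff their values \<open>n |z|\<^sub>w + r \<cdot> z\<close> agree, so each
  fibre is a disjoint union of \<^emph>\<open>layers\<close>, on which the bidegree \<open>(|z|\<^sub>w, r \<cdot> z)\<close> is constant. The
  relation of lying in the same layer (\<open>bihom\<close>) does not depend on \<open>n\<close>.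

  A set \<open>\<sigma>\<close> of relations is a presentation iff every fibre is connected by the pairs in \<open>\<sigma>\<close> together
  with the pairs of factorizations that use a common generator (\<open>is_presentation_iff_connected\<close>).
  For large \<open>n\<close> this connectedness can be tested layer by layer.

  The reason is an exchange argument. By the pigeonhole principle, among \<open>w\<^sub>1 p\<close> generators other
  than the first and the last there are some whose sum has the bidegree of a sum of copies of the
  first and the last generator. Hence each layer has a representative that uses boundedly many
  inner generators, and the representative may be chosen to share a given generator with a given
  element. If the fibre has a shorter layer, then the first generator must occur in the
  representative, because inner generators alone cannot account for the length; if it has a longer
  layer, then the last one must occur. So a layer is connected as soon as its fibre has another
  layer, and a fibre with three layers is connected altogether. What a presentation has to provide
  is, first, relations inside layers, a condition that does not involve \<open>n\<close>, and, second, one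
  relation for each fibre with exactly two layers that have disjoint supports, its \<open>betti_pair\<close>
  (\<open>connected_iff_layers\<close>).

  Finally, \<open>\<Phi>\<^sub>n\<close> fixes the relations inside layers. On a relation of length difference \<open>\<ell>\<close> it adds
  \<open>\<ell> w\<^sub>k e\<^sub>1\<close> to the longer side and \<open>\<ell> w\<^sub>1 e\<^sub>k\<close> to the shorter one. By the exchange argument
  these summands can be removed again from every layer concerned, without changing supports.
  So betti pairs for \<open>n\<close> and for \<open>n + p\<close> correspond to each other (\<open>betti_pair_shift\<close>,
  \<open>betti_pair_unshift\<close>), and a subset of \<open>K n\<close> is a presentation iff its image is one
  (\<open>presentation_Phi_iff\<close>). Applied to \<open>\<rho>\<close> and to all its subsets, this preserves minimality.
  If \<open>p = 0\<close> then all slopes \<open>r\<^sub>i / w\<^sub>i\<close> agree, every fibre is a single layer, and \<open>\<Phi>\<^sub>n\<close> is the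
  identity on \<open>K n\<close>.
\<close>

section \<open>Presentations via shared generators\<close>

definition share_generator :: "nat ^ 'k \<Rightarrow> nat ^ 'k \<Rightarrow> bool" where
  "share_generator x y \<longleftrightarrow> (\<exists>i. 0 < x $ i \<and> 0 < y $ i)"

definition sharing_pairs :: "nat ^ 'k \<Rightarrow> (nat ^ 'k) rel" where
  "sharing_pairs g = {(x, y) \<in> factorization_kernel g. share_generator x y}"

lemma share_generator_sym: "share_generator x y \<Longrightarrow> share_generator y x"
  by (auto simp: share_generator_def)

lemma smult_axis_nth: "((c::nat) *s axis i 1) $ j = (if j = i then c else 0)"
  by (simp add: axis_def)

lemma vec_subtract_add:
  fixes x d :: "nat ^ 'k"
  assumes "d \<le> x"
  shows "x = (x - d) + d"
  using assms by (simp add: vec_eq_iff less_eq_vec_def)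

lemma smult_axis_le: "c *s axis i (1::nat) \<le> x \<longleftrightarrow> c \<le> x $ i"
  by (auto simp: less_eq_vec_def smult_axis_nth simp del: One_nat_def vector_smult_component)

lemma factorization_kernel_add_cancel:
  "(x + u, y + u) \<in> factorization_kernel g \<longleftrightarrow> (x, y) \<in> factorization_kernel g"
  by (simp add: factorization_kernel_def factorization_hom_add)

text \<open>
  The connectivity relation is itself a congruence: translating a pair by a nonzero vector makes
  its two sides share a generator.
\<close>

lemma hull_subset_connected:
  assumes \<sigma>: "\<sigma> \<subseteq> factorization_kernel g"
  shows "is_congruence hull \<sigma> \<subseteq> (sharing_pairs g \<union> (\<sigma> \<union> \<sigma>\<inverse>))\<^sup>*"
proof (rule hull_minimal)
  define T where "T = sharing_pairs g \<union> (\<sigma> \<union> \<sigma>\<inverse>)"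
  have T_kernel: "T \<subseteq> factorization_kernel g"
    using \<sigma> by (auto simp: T_def sharing_pairs_def factorization_kernel_def)
  have "sym T"
    by (auto simp: T_def sym_def sharing_pairs_def factorization_kernel_def share_generator_sym)
  have step: "(x + u, y + u) \<in> T\<^sup>*" if "(x, y) \<in> T" for x y u
  proof (cases "u = 0")
    case False
    then obtain i where "0 < u $ i"
      by (auto simp: vec_eq_iff)
    then have "(x + u, y + u) \<in> T"
      using that T_kernel factorization_kernel_add_cancel[of x u y g]
      by (auto simp: T_def sharing_pairs_def share_generator_def)
    then show ?thesis by blast
  qed (use that in simp)
  have "(x + u, y + u) \<in> T\<^sup>*" if "(x, y) \<in> T\<^sup>*" for x y u
    using that
  proof (induction rule: rtrancl_induct)
    case (step y z)
    then show ?case using \<open>\<And>x y u. (x, y) \<in> T \<Longrightarrow> (x + u, y + u) \<in> T\<^sup>*\<close>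
      by (meson rtrancl_trans)
  qed simp
  moreover have "equiv UNIV (T\<^sup>*)"
    using \<open>sym T\<close> by (simp add: equiv_def refl_rtrancl sym_rtrancl trans_rtrancl)
  ultimately show "is_congruence (T\<^sup>*)"
    by (simp add: is_congruence_def)
qed auto

text \<open>
  Cancelling a shared generator gives a relation in a smaller degree, as generators are positive.
  By induction on the degree, every such step of a connecting path lies in the congruence generated
  by \<open>\<sigma>\<close>.
\<close>

lemma connected_subset_hull:
  assumes pos: "\<forall>i. 0 < g $ i" and \<sigma>: "\<sigma> \<subseteq> factorization_kernel g"
    and conn: "factorization_kernel g \<subseteq> (sharing_pairs g \<union> (\<sigma> \<union> \<sigma>\<inverse>))\<^sup>*"
  shows "factorization_kernel g \<subseteq> is_congruence hull \<sigma>"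
proof -
  define H where "H = is_congruence hull \<sigma>"
  have H: "is_congruence H" "\<sigma> \<subseteq> H"
    by (simp_all add: H_def is_congruence_hull hull_subset)
  then have eqv: "refl H" "sym H" "trans H"
    and translate: "\<And>x y u. (x, y) \<in> H \<Longrightarrow> (x + u, y + u) \<in> H"
    by (auto simp: is_congruence_def equiv_def)
  have "(x, y) \<in> H" if "(x, y) \<in> factorization_kernel g" for x y
    using that
  proof (induction "factorization_hom g x" arbitrary: x y rule: less_induct)
    case less
    have "(x, y) \<in> (sharing_pairs g \<union> (\<sigma> \<union> \<sigma>\<inverse>))\<^sup>*"
      using less.prems conn by blast
    then have "(x, y) \<in> H \<and> factorization_hom g y = factorization_hom g x"
    proof (induction rule: rtrancl_induct)
      case base
      then show ?case using \<open>refl H\<close> by (simp add: refl_on_def)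
    next
      case (step u v)
      have deg: "factorization_hom g v = factorization_hom g u"
        using step.hyps(2) \<sigma> by (auto simp: sharing_pairs_def factorization_kernel_def)
      have "(u, v) \<in> H"
      proof (cases "(u, v) \<in> sharing_pairs g")
        case True
        then obtain i where i: "0 < u $ i" "0 < v $ i"
          and uv: "(u, v) \<in> factorization_kernel g"
          by (auto simp: sharing_pairs_def share_generator_def)
        define e where "e = 1 *s axis i (1::nat)"
        have u: "u = (u - e) + e" and v: "v = (v - e) + e"
          using i by (auto intro!: vec_subtract_add simp: e_def smult_axis_le simp del: One_nat_def vector_smult_lid)
        have "factorization_hom g e = g $ i"
          unfolding e_def factorization_hom_axis by simp
        then have "factorization_hom g (u - e) < factorization_hom g x"
          using step.IH u pos factorization_hom_add[of g "u - e" e] by (metis less_add_same_cancel1)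
        moreover have "(u - e, v - e) \<in> factorization_kernel g"
          using uv u v factorization_kernel_add_cancel by metis
        ultimately have "(u - e, v - e) \<in> H"
          using less.hyps by blast
        then show ?thesis using translate u v by metis
      next
        case False
        then show ?thesis using step.hyps(2) H(2) \<open>sym H\<close> by (auto dest: symD)
      qed
      then show ?case using step.IH deg \<open>trans H\<close> by (auto dest: transD)
    qed
    then show ?case by simp
  qed
  then show ?thesis by (auto simp: H_def)
qed

lemma is_presentation_iff_connected:
  assumes "\<forall>i. 0 < g $ i" and "\<sigma> \<subseteq> factorization_kernel g"
  shows "is_presentation g \<sigma> \<longleftrightarrow>
    factorization_kernel g \<subseteq> (sharing_pairs g \<union> (\<sigma> \<union> \<sigma>\<inverse>))\<^sup>*"
proof -
  have "is_congruence hull \<sigma> \<subseteq> factorization_kernel g"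
    using assms(2) is_congruence_factorization_kernel by (rule hull_minimal)
  then show ?thesis
    using assms hull_subset_connected connected_subset_hull
    unfolding is_presentation_def by blast
qed


section \<open>Exchanging a bounded subvector for the extreme generators\<close>

text \<open>
  The members of the chain are the partial sums of \<open>z\<close> written as a sum of unit vectors; they
  are the pigeons in the next lemma.
\<close>

lemma long_chain_below:
  fixes z :: "nat ^ 'k"
  assumes "m \<le> (\<Sum>i\<in>UNIV. z $ i)"
  shows "\<exists>f. (\<forall>j\<le>m. f j \<le> z \<and> (\<Sum>i\<in>UNIV. f j $ i) = j) \<and> (\<forall>j l. j \<le> l \<and> l \<le> m \<longrightarrow> f j \<le> f l)"
  using assms
proof (induction m)
  case 0
  show ?case by (rule exI[of _ "\<lambda>_. 0"]) (simp add: less_eq_vec_def)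
next
  case (Suc m)
  then obtain f where f: "\<And>j. j \<le> m \<Longrightarrow> f j \<le> z \<and> (\<Sum>i\<in>UNIV. f j $ i) = j"
    "\<And>j l. j \<le> l \<Longrightarrow> l \<le> m \<Longrightarrow> f j \<le> f l"
    by auto
  have "\<exists>i. f m $ i < z $ i"
  proof (rule ccontr)
    assume "\<nexists>i. f m $ i < z $ i"
    then have "(\<Sum>i\<in>UNIV. z $ i) \<le> (\<Sum>i\<in>UNIV. f m $ i)"
      by (intro sum_mono) (simp add: not_less)
    then show False using f(1)[of m] Suc.prems by simp
  qed
  then obtain i where i: "f m $ i < z $ i" ..
  define v where "v = f m + 1 *s axis i 1"
  have vi: "v $ j = f m $ j + (if j = i then 1 else 0)" for j
    by (simp add: v_def axis_def)
  have "(\<Sum>j\<in>UNIV. v $ j) = Suc m"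
    using f(1)[of m] by (simp add: vi sum.distrib)
  moreover have "v \<le> z"
    using f(1)[of m] i by (auto simp: less_eq_vec_def vi)
  moreover have "f m \<le> v"
    by (simp add: less_eq_vec_def vi)
  ultimately show ?case
    using f by (intro exI[of _ "f(Suc m := v)"])
      (auto simp: le_Suc_eq intro: order_trans)
qed

lemma pigeonhole_below:
  fixes z :: "nat ^ 'k"
  assumes "finite S" "range \<phi> \<subseteq> S" "card S \<le> (\<Sum>i\<in>UNIV. z $ i)"
  obtains a b where "a \<le> b" "b \<le> z" "a \<noteq> b" "\<phi> a = \<phi> b"
proof -
  obtain f where f: "\<And>j. j \<le> card S \<Longrightarrow> f j \<le> z \<and> (\<Sum>i\<in>UNIV. f j $ i) = j"
    "\<And>j l. j \<le> l \<Longrightarrow> l \<le> card S \<Longrightarrow> f j \<le> f l"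
    using long_chain_below[OF assms(3)] by blast
  have "card ((\<lambda>j. \<phi> (f j)) ` {..card S}) \<le> card S"
    using assms(1,2) by (intro card_mono) auto
  then have "\<not> inj_on (\<lambda>j. \<phi> (f j)) {..card S}"
    by (intro pigeonhole) simp
  then obtain j l where "j \<le> card S" "l \<le> card S" "j < l" "\<phi> (f j) = \<phi> (f l)"
    unfolding inj_on_def by (metis atMost_iff linorder_neqE_nat)
  then show thesis
    using that[of "f j" "f l"] f by (metis nat_less_le)
qed

lemma weight_add: "weight v (x + y) = weight v x + weight v y"
  by (simp add: weight_def distrib_left sum.distrib)

lemma weight_axis: "weight v (c *s axis i 1) = c * v $ i"
proof -
  have "weight v (c *s axis i 1) = (\<Sum>j\<in>UNIV. if j = i then c * v $ j else 0)"
    unfolding weight_def smult_axis_nth by (rule sum.cong) auto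
  then show ?thesis by simp
qed

lemma factorization_hom_shifted_gens_eq:
  "factorization_hom (shifted_gens w r m) z = m * weight w z + weight r z"
  by (simp add: factorization_hom_def shifted_gens_def weight_def sum_distrib_left
      algebra_simps sum.distrib)

definition extremes :: "nat \<Rightarrow> nat \<Rightarrow> nat ^ 'k::{finite,linorder}" where
  "extremes a b = a *s axis first_ix 1 + b *s axis last_ix 1"

lemma weight_extremes: "weight v (extremes a b) = a * v $ first_ix + b * v $ last_ix"
  unfolding extremes_def weight_add weight_axis ..

lemma extremes_nth:
  "extremes a b $ j = (if j = first_ix then a else 0) + (if j = last_ix then b else 0)"
  unfolding extremes_def vector_add_component smult_axis_nth ..

text \<open>
  Since \<open>p\<close> is the determinant of \<open>(w\<^sub>1, r\<^sub>1)\<close> and \<open>(w\<^sub>k, r\<^sub>k)\<close>, its positivity makes these two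
  bidegrees a basis of the rational plane.
\<close>

locale shifted_family =
  fixes w r :: "nat ^ 'k::{finite,linorder}"
  assumes w_pos: "1 \<le> w $ i"
    and slopes: "i \<le> j \<Longrightarrow> real (r $ i) / real (w $ i) \<le> real (r $ j) / real (w $ j)"
    and period_pos: "0 < shift_period w r"
begin

abbreviation w1 :: int where "w1 \<equiv> int (w $ first_ix)"
abbreviation wk :: int where "wk \<equiv> int (w $ last_ix)"
abbreviation r1 :: int where "r1 \<equiv> int (r $ first_ix)"
abbreviation rk :: int where "rk \<equiv> int (r $ last_ix)"
abbreviation p :: int where "p \<equiv> int (shift_period w r)"
abbreviation W :: nat where "W \<equiv> Max (range (($) w))"
abbreviation R :: nat where "R \<equiv> Max (range (($) r))"

definition bihom :: "(nat, 'k) vec \<Rightarrow> (nat, 'k) vec \<Rightarrow> bool" where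
  "bihom x y \<longleftrightarrow> weight w x = weight w y \<and> weight r x = weight r y"

text \<open>
  In the basis \<open>(w\<^sub>1, r\<^sub>1)\<close>, \<open>(w\<^sub>k, r\<^sub>k)\<close> the bidegree has the coordinates \<open>high / p\<close> and \<open>low / p\<close>.
  Both are nonnegative on factorizations because the first and the last generator have the extreme
  slopes.
\<close>

definition low :: "(nat, 'k) vec \<Rightarrow> int" where
  "low z = w1 * int (weight r z) - r1 * int (weight w z)"

definition high :: "(nat, 'k) vec \<Rightarrow> int" where
  "high z = rk * int (weight w z) - wk * int (weight r z)"

definition inner_size :: "(nat, 'k) vec \<Rightarrow> nat" where
  "inner_size z = (\<Sum>i\<in>-{first_ix, last_ix}. z $ i)"

definition large :: "nat \<Rightarrow> bool" where
  "large m \<longleftrightarrow> (w $ first_ix)\<^sup>2 * W * R\<^sup>2 < m"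

lemma p_eq: "p = w1 * rk - wk * r1"
  using int_shift_period[of w r] w_pos slopes by simp

lemma w1_pos: "1 \<le> w1" and wk_pos: "1 \<le> wk"
  using w_pos[of first_ix] w_pos[of last_ix] by auto

lemma first_neq_last: "first_ix \<noteq> (last_ix :: 'k)"
  using period_pos unfolding shift_period_def by auto

lemma cross_slopes:
  assumes "i \<le> j"
  shows "int (r $ i) * int (w $ j) \<le> int (r $ j) * int (w $ i)"
proof -
  have "real (w $ i) > 0" "real (w $ j) > 0"
    using w_pos[of i] w_pos[of j] by simp_all
  with slopes[OF assms] have "real (r $ i) * real (w $ j) \<le> real (r $ j) * real (w $ i)"
    by (simp add: divide_simps split: if_splits)
  then show ?thesis
    by (metis of_nat_le_iff of_nat_mult)
qed

lemma low_coeff_nonneg: "0 \<le> w1 * int (r $ i) - r1 * int (w $ i)"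
  using cross_slopes[of first_ix i] by (simp add: first_ix_def mult.commute)

lemma high_coeff_nonneg: "0 \<le> rk * int (w $ i) - wk * int (r $ i)"
  using cross_slopes[of i last_ix] by (simp add: last_ix_def mult.commute)

lemma low_eq_sum: "low z = (\<Sum>i\<in>UNIV. int (z $ i) * (w1 * int (r $ i) - r1 * int (w $ i)))"
  by (simp add: low_def weight_def sum_distrib_left sum_subtractf algebra_simps)

lemma high_eq_sum: "high z = (\<Sum>i\<in>UNIV. int (z $ i) * (rk * int (w $ i) - wk * int (r $ i)))"
  by (simp add: high_def weight_def sum_distrib_left sum_subtractf algebra_simps)

lemma low_nonneg: "0 \<le> low z"
  unfolding low_eq_sum using low_coeff_nonneg by (intro sum_nonneg) simp

lemma high_nonneg: "0 \<le> high z"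
  unfolding high_eq_sum using high_coeff_nonneg by (intro sum_nonneg) simp

lemma low_add: "low (x + y) = low x + low y"
  by (simp add: low_def weight_add algebra_simps)

lemma cramer_weight: "p * int (weight w z) = w1 * high z + wk * low z"
  by (simp add: p_eq low_def high_def algebra_simps)

lemma cramer_residue: "p * int (weight r z) = r1 * high z + rk * low z"
  by (simp add: p_eq low_def high_def algebra_simps)

text \<open>
  The combinations of \<open>(w\<^sub>1, r\<^sub>1)\<close>, \<open>(w\<^sub>k, r\<^sub>k)\<close> with integers \<open>a\<close>, \<open>b\<close> form a lattice of index \<open>p\<close> in the
  bidegrees \<open>(d, e)\<close>, and of index \<open>w\<^sub>1 p\<close> in the coordinates \<open>(d, w\<^sub>1 e - r\<^sub>1 d)\<close> used here. Two
  partial sums of \<open>z\<close> in the same class differ by a subvector \<open>u\<close> whose bidegree is in the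
  lattice; nonnegativity of \<open>low\<close> and \<open>high\<close> makes its coordinates \<open>a\<close>, \<open>b\<close> nonnegative.
\<close>

lemma exchange:
  assumes "w $ first_ix * shift_period w r \<le> inner_size z"
  obtains u a b where "u \<le> z" "u $ first_ix = 0" "u $ last_ix = 0" "0 < inner_size u"
    "bihom u (extremes a b)"
proof -
  define zi :: "(nat, 'k) vec" where "zi = (\<chi> i. if i \<in> {first_ix, last_ix} then 0 else z $ i)"
  \<comment> \<open>The class of \<open>x\<close> modulo the lattice spanned by \<open>(w1, 0)\<close> and \<open>(wk, p)\<close>, the values of
    \<open>(weight w, low)\<close> on the first and the last generator.\<close>
  define \<phi> where "\<phi> = (\<lambda>x. (low x mod p, (int (weight w x) - wk * (low x div p)) mod w1))"
  define S where "S = {0..<p} \<times> {0..<w1}"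
  have "range \<phi> \<subseteq> S"
    using period_pos w1_pos by (auto simp: \<phi>_def S_def)
  moreover have "card S \<le> (\<Sum>i\<in>UNIV. zi $ i)"
  proof -
    have "(\<Sum>i\<in>UNIV. zi $ i) = inner_size z"
      unfolding inner_size_def by (rule sum.mono_neutral_cong_right) (auto simp: zi_def)
    then show ?thesis using assms by (simp add: S_def mult.commute)
  qed
  ultimately obtain c d where cd: "c \<le> d" "d \<le> zi" "c \<noteq> d" "\<phi> c = \<phi> d"
    using pigeonhole_below[of S \<phi> zi] unfolding S_def by blast
  define u where "u = d - c"
  have d: "d = u + c"
    using vec_subtract_add[OF cd(1)] by (simp add: u_def)
  have u_le: "u $ i \<le> zi $ i" for i
    using cd(2) by (simp add: u_def less_eq_vec_def le_diff_conv trans_le_add1)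
  have "zi $ i \<le> z $ i" for i
    by (simp add: zi_def)
  then have "u \<le> z"
    unfolding less_eq_vec_def using u_le order_trans by blast
  have ends: "u $ first_ix = 0" "u $ last_ix = 0"
    using u_le[of first_ix] u_le[of last_ix] by (auto simp: zi_def)
  have "u \<noteq> 0"
    using cd(3) d by auto
  then obtain i where i: "0 < u $ i"
    by (auto simp: vec_eq_iff)
  then have "i \<in> -{first_ix, last_ix}"
    using ends by auto
  then have "0 < inner_size u"
    unfolding inner_size_def using i by (intro sum_pos2[of _ i]) auto

  define b where "b = low d div p - low c div p"
  have "low u = low d - low c"
    using d low_add[of u c] by simp
  also have "\<dots> = p * (low d div p) + low d mod p - (p * (low c div p) + low c mod p)"
    by simp
  also have "\<dots> = p * b"
  proof -
    have "low d mod p = low c mod p"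
      using cd(4) by (simp add: \<phi>_def)
    then show ?thesis unfolding b_def right_diff_distrib by linarith
  qed
  finally have low_u: "low u = p * b" .
  have "(int (weight w d) - wk * (low d div p)) mod w1 = (int (weight w c) - wk * (low c div p)) mod w1"
    using cd(4) by (simp add: \<phi>_def)
  then have "w1 dvd (int (weight w d) - wk * (low d div p)) - (int (weight w c) - wk * (low c div p))"
    by (simp add: mod_eq_dvd_iff)
  also have "(int (weight w d) - wk * (low d div p)) - (int (weight w c) - wk * (low c div p))
      = int (weight w u) - wk * b"
    by (simp add: d weight_add b_def algebra_simps)
  finally obtain a where "int (weight w u) - wk * b = w1 * a" ..
  then have w_u: "int (weight w u) = w1 * a + wk * b" by simp
  have "w1 * high u = w1 * (p * a)"
    using cramer_weight[of u] unfolding low_u w_u by (auto simp: algebra_simps)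
  then have high_u: "high u = p * a"
    using w1_pos by (metis mult_cancel_left not_one_le_zero)
  have "p * int (weight r u) = p * (r1 * a + rk * b)"
    using cramer_residue[of u] unfolding low_u high_u by (simp add: algebra_simps)
  then have r_u: "int (weight r u) = r1 * a + rk * b"
    using period_pos by simp
  have "0 \<le> a" "0 \<le> b"
    using high_nonneg[of u] low_nonneg[of u] period_pos
    unfolding low_u high_u by (simp_all add: zero_le_mult_iff)
  then obtain a' b' where "a = int a'" "b = int b'"
    using nonneg_int_cases by metis
  then have "int (weight w u) = int (weight w (extremes a' b'))"
    "int (weight r u) = int (weight r (extremes a' b'))"
    unfolding weight_extremes w_u r_u by (simp_all add: algebra_simps)
  then have "bihom u (extremes a' b')"
    unfolding bihom_def by (simp only: of_nat_eq_iff)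
  with \<open>u \<le> z\<close> ends \<open>0 < inner_size u\<close> show thesis by (rule that)
qed

lemma bihom_refl: "bihom x x"
  by (simp add: bihom_def)

lemma bihom_sym: "bihom x y \<Longrightarrow> bihom y x"
  by (simp add: bihom_def)

lemma bihom_trans: "bihom x y \<Longrightarrow> bihom y z \<Longrightarrow> bihom x z"
  by (simp add: bihom_def)

lemma bihom_add_right: "bihom (x + u) (y + u) \<longleftrightarrow> bihom x y"
  by (simp add: bihom_def weight_add)

lemma inner_size_add: "inner_size (x + y) = inner_size x + inner_size y"
  by (simp add: inner_size_def sum.distrib)

lemma inner_size_extremes: "inner_size (extremes a b) = 0"
  by (auto simp: inner_size_def extremes_nth)

lemma inner_size_axis: "inner_size (1 *s axis i 1) \<le> 1"
proof -
  have "inner_size (1 *s axis i 1) \<le> (\<Sum>j\<in>UNIV. (1 *s axis i (1::nat)) $ j)"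
    unfolding inner_size_def by (rule sum_mono2) auto
  then show ?thesis unfolding smult_axis_nth by simp
qed

text \<open>
  A representative with the least number of inner generators admits no further exchange. Setting
  one copy of generator \<open>i\<close> aside before each exchange keeps it in the support.
\<close>

lemma small_representative:
  obtains y where "bihom y z" "0 < z $ i \<longrightarrow> 0 < y $ i"
    "inner_size y \<le> w $ first_ix * shift_period w r"
proof -
  define P where "P y \<longleftrightarrow> bihom y z \<and> (0 < z $ i \<longrightarrow> 0 < y $ i)" for y
  have "P z" by (simp add: P_def bihom_refl)
  then obtain y where y: "P y" and least: "\<And>y'. P y' \<Longrightarrow> inner_size y \<le> inner_size y'"
    using ex_has_least_nat[of P z inner_size] by blast
  have "inner_size y \<le> w $ first_ix * shift_period w r"
  proof (rule ccontr)
    assume big: "\<not> ?thesis"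
    define e where "e = (if 0 < z $ i then 1 *s axis i (1::nat) else 0)"
    have e_le: "e \<le> y"
      using y unfolding e_def P_def
      by (auto simp: smult_axis_le less_eq_vec_def smult_axis_nth
          simp del: vector_smult_lid One_nat_def vector_smult_component)
    define y0 where "y0 = y - e"
    have y_eq: "y = y0 + e"
      unfolding y0_def by (rule vec_subtract_add[OF e_le])
    have "inner_size e \<le> 1"
      using inner_size_axis[of i] by (simp add: e_def inner_size_def)
    then have "w $ first_ix * shift_period w r \<le> inner_size y0"
      using big inner_size_add[of y0 e] y_eq by simp
    then obtain u a b where u: "u \<le> y0" "0 < inner_size u" "bihom u (extremes a b)"
      using exchange by metis
    define y1 where "y1 = y0 - u"
    have y0_eq: "y0 = y1 + u"
      unfolding y1_def by (rule vec_subtract_add[OF u(1)])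
    define y' where "y' = y1 + extremes a b + e"
    have "bihom y' y"
      using u(3) by (simp add: y'_def y_eq y0_eq bihom_def weight_add)
    moreover have "0 < y' $ i" if "0 < z $ i"
      using that by (simp add: y'_def e_def)
    ultimately have "P y'"
      using y by (auto simp: P_def intro: bihom_trans)
    moreover have "inner_size y' < inner_size y"
      using u(2) inner_size_extremes[of a b] by (simp add: y'_def y_eq y0_eq inner_size_add)
    ultimately show False using least by force
  qed
  with y that show thesis by (auto simp: P_def)
qed

lemma bihom_high: "bihom x y \<Longrightarrow> high x = high y"
  and bihom_low: "bihom x y \<Longrightarrow> low x = low y"
  by (simp_all add: bihom_def high_def low_def)

lemma w_le_W: "w $ i \<le> W" and r_le_R: "r $ i \<le> R"
  by simp_all

lemma sum_extremes:
  fixes f :: "'k \<Rightarrow> int"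
  shows "(\<Sum>i\<in>UNIV. f i) = f first_ix + f last_ix + (\<Sum>i\<in>-{first_ix, last_ix}. f i)"
proof -
  have "(\<Sum>i\<in>UNIV. f i) = sum f {first_ix, last_ix} + (\<Sum>i\<in>-{first_ix, last_ix}. f i)"
    by (subst sum.union_disjoint[symmetric]) (auto intro: sum.cong)
  then show ?thesis using first_neq_last by simp
qed

lemma inner_sum_le:
  assumes "\<And>i. f i \<le> c"
  shows "(\<Sum>i\<in>-{first_ix, last_ix}. int (z $ i) * f i) \<le> int (inner_size z) * c"
proof -
  have "(\<Sum>i\<in>-{first_ix, last_ix}. int (z $ i) * f i) \<le> (\<Sum>i\<in>-{first_ix, last_ix}. int (z $ i) * c)"
    by (intro sum_mono mult_left_mono assms) simp
  then show ?thesis by (simp add: inner_size_def sum_distrib_right)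
qed

lemma high_le: "high z \<le> p * int (z $ first_ix) + int (inner_size z) * (int R * int W)"
proof -
  have "rk * int (w $ i) - wk * int (r $ i) \<le> int R * int W" for i
  proof -
    have "rk * int (w $ i) \<le> int R * int W"
      using w_le_W[of i] r_le_R[of last_ix] by (intro mult_mono) auto
    then show ?thesis by (smt (verit) of_nat_0_le_iff mult_nonneg_nonneg)
  qed
  then show ?thesis
    using inner_sum_le[of "\<lambda>i. rk * int (w $ i) - wk * int (r $ i)" "int R * int W" z]
    unfolding high_eq_sum sum_extremes by (simp add: p_eq algebra_simps)
qed

lemma low_le: "low z \<le> p * int (z $ last_ix) + int (inner_size z) * (int R * w1)"
proof -
  have "w1 * int (r $ i) - r1 * int (w $ i) \<le> int R * w1" for i
  proof -
    have "w1 * int (r $ i) \<le> w1 * int R"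
      using r_le_R[of i] by (intro mult_left_mono) auto
    then show ?thesis by (smt (verit) of_nat_0_le_iff mult_nonneg_nonneg mult.commute)
  qed
  then show ?thesis
    using inner_sum_le[of "\<lambda>i. w1 * int (r $ i) - r1 * int (w $ i)" "int R * w1" z]
    unfolding low_eq_sum sum_extremes by (simp add: p_eq algebra_simps)
qed

lemma p_le: "p \<le> w1 * int R"
proof -
  have "p \<le> w1 * rk"
    unfolding p_eq by simp
  also have "\<dots> \<le> w1 * int R"
    using r_le_R by (intro mult_left_mono) auto
  finally show ?thesis .
qed

text \<open>
  The bound on \<open>m\<close> is what makes the inner part of a small representative negligible: it has at
  most \<open>w\<^sub>1 p \<le> w\<^sub>1\<^sup>2 R\<close> entries, each contributing at most \<open>R W\<close> to \<open>high\<close> and \<open>R w\<^sub>1\<close> to \<open>low\<close>.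
  The rest of \<open>high\<close> comes from the first generator, and the rest of \<open>low\<close> from the last.
\<close>

lemma concentrate:
  assumes "large m"
  obtains y where "bihom y z" "0 < z $ i \<longrightarrow> 0 < y $ i"
    "high z < p * int (y $ first_ix) + int m"
    "low z < p * int (y $ last_ix) + w1 * int m"
proof -
  obtain y where y: "bihom y z" "0 < z $ i \<longrightarrow> 0 < y $ i"
    and size: "inner_size y \<le> w $ first_ix * shift_period w r"
    using small_representative[of z i] by blast
  have "int (inner_size y) \<le> w1 * p"
    using size by (metis of_nat_le_iff of_nat_mult)
  also have "\<dots> \<le> w1 * (w1 * int R)"
    using p_le by (intro mult_left_mono) auto
  finally have size': "int (inner_size y) \<le> w1 * (w1 * int R)" .
  have m: "w1 * w1 * int W * (int R * int R) < int m"
    using assms unfolding large_def power2_eq_square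
    by (metis of_nat_less_iff of_nat_mult)
  have "high z \<le> p * int (y $ first_ix) + int (inner_size y) * (int R * int W)"
    using high_le[of y] bihom_high[OF y(1)] by simp
  also have "int (inner_size y) * (int R * int W) \<le> w1 * (w1 * int R) * (int R * int W)"
    using size' by (intro mult_right_mono) auto
  also have "\<dots> < int m"
    using m by (simp add: algebra_simps)
  finally have high: "high z < p * int (y $ first_ix) + int m" by simp
  have "1 \<le> int W"
    using w_le_W[of first_ix] w1_pos by linarith
  then have "w1 * w1 * 1 * (int R * int R) \<le> w1 * w1 * int W * (int R * int R)"
    by (intro mult_right_mono mult_left_mono) auto
  then have m': "w1 * w1 * (int R * int R) < int m"
    using m by simp
  have "low z \<le> p * int (y $ last_ix) + int (inner_size y) * (int R * w1)"
    using low_le[of y] bihom_low[OF y(1)] by simp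
  also have "int (inner_size y) * (int R * w1) \<le> w1 * (w1 * int R) * (int R * w1)"
    using size' by (intro mult_right_mono) auto
  also have "\<dots> = w1 * (w1 * w1 * (int R * int R))"
    by (simp add: algebra_simps)
  also have "\<dots> < w1 * int m"
    using m' w1_pos by (intro mult_strict_left_mono) auto
  finally have "low z < p * int (y $ last_ix) + w1 * int m" by simp
  with y high show thesis by (rule that)
qed


section \<open>Fibres and their layers of constant weight\<close>

abbreviation K :: "nat \<Rightarrow> (nat, 'k) vec rel" where
  "K m \<equiv> factorization_kernel (shifted_gens w r m)"

lemma kernel_iff: "(x, y) \<in> K m \<longleftrightarrow> m * weight w x + weight r x = m * weight w y + weight r y"
  by (simp add: factorization_kernel_def factorization_hom_shifted_gens_eq)

lemma bihom_iff_kernel: "bihom x y \<longleftrightarrow> (x, y) \<in> K m \<and> weight w x = weight w y"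
  by (auto simp: kernel_iff bihom_def)

text \<open>
  Passing to another layer of the same fibre changes both functionals by multiples of about \<open>m\<close>,
  the scale against which inner generators are negligible.
\<close>

lemma layer_gap:
  assumes "(x, y) \<in> K m" "weight w x = weight w y + l"
  shows "high x = high y + int l * (rk + wk * int m)"
    and "low y = low x + int l * (r1 + w1 * int m)"
proof -
  have "m * weight w y + weight r y = m * weight w x + weight r x"
    using assms(1) by (simp add: kernel_iff)
  then have "weight r y = weight r x + l * m"
    using assms(2) by (simp add: algebra_simps)
  then show "high x = high y + int l * (rk + wk * int m)"
    "low y = low x + int l * (r1 + w1 * int m)"
    using assms(2) by (simp_all add: high_def low_def algebra_simps)
qed

lemma long_reaches_first:
  assumes "large m" "(x, y) \<in> K m" "weight w y < weight w x"
  obtains x' where "bihom x' x" "0 < x' $ first_ix" "0 < x $ i \<longrightarrow> 0 < x' $ i"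
proof -
  obtain l where l: "weight w x = weight w y + l" "0 < l"
    using assms(3) by (metis less_imp_add_positive)
  obtain x' where x': "bihom x' x" "0 < x $ i \<longrightarrow> 0 < x' $ i"
    "high x < p * int (x' $ first_ix) + int m" "low x < p * int (x' $ last_ix) + w1 * int m"
    by (rule concentrate[OF assms(1), of x i])
  have "1 * (1 * int m) \<le> int l * (wk * int m)"
    using l(2) wk_pos by (intro mult_mono) auto
  also have "\<dots> \<le> int l * (rk + wk * int m)"
    by (intro mult_left_mono) auto
  also have "\<dots> \<le> high x"
    using layer_gap(1)[OF assms(2) l(1)] high_nonneg[of y] by simp
  finally have "0 < p * int (x' $ first_ix)"
    using x'(3) by simp
  then have "0 < x' $ first_ix"
    by (cases "x' $ first_ix") auto
  with x'(1,2) show thesis by (intro that)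
qed

lemma short_reaches_last:
  assumes "large m" "(x, y) \<in> K m" "weight w y < weight w x"
  obtains y' where "bihom y' y" "0 < y' $ last_ix" "0 < y $ i \<longrightarrow> 0 < y' $ i"
proof -
  obtain l where l: "weight w x = weight w y + l" "0 < l"
    using assms(3) by (metis less_imp_add_positive)
  obtain y' where y': "bihom y' y" "0 < y $ i \<longrightarrow> 0 < y' $ i"
    "high y < p * int (y' $ first_ix) + int m" "low y < p * int (y' $ last_ix) + w1 * int m"
    by (rule concentrate[OF assms(1), of y i])
  have "1 * (w1 * int m) \<le> int l * (r1 + w1 * int m)"
    using l(2) by (intro mult_mono) auto
  also have "\<dots> \<le> low y"
    using layer_gap(2)[OF assms(2) l(1)] low_nonneg[of x] by simp
  finally have "0 < p * int (y' $ last_ix)"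
    using y'(4) by simp
  then have "0 < y' $ last_ix"
    by (cases "y' $ last_ix") auto
  with y'(1,2) show thesis by (intro that)
qed

text \<open>
  Shifting \<open>n\<close> to \<open>n + p\<close> has to be compensated by a vector that depends on the position of a layer
  between the longer side \<open>x\<close> and the shorter side \<open>y\<close> of a relation: \<open>shift_layer a b\<close> is the
  compensation for the layer of weight \<open>|x|\<^sub>w - a = |y|\<^sub>w + b\<close>. It adds \<open>(a + b) w\<^sub>1 w\<^sub>k\<close> to the
  weight wherever the layer lies, and for \<open>a = 0\<close> and \<open>b = 0\<close> it is what \<open>\<Phi>\<^sub>n\<close> adds to the two
  sides.
\<close>

abbreviation shift_layer :: "nat \<Rightarrow> nat \<Rightarrow> (nat, 'k) vec" where
  "shift_layer a b \<equiv> extremes (b * w $ last_ix) (a * w $ first_ix)"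

lemma weight_shift_layer:
  "weight w (shift_layer a b) = (a + b) * (w $ first_ix * w $ last_ix)"
  by (simp add: weight_extremes algebra_simps)

lemma period_nat_eq: "shift_period w r + w $ last_ix * r $ first_ix = w $ first_ix * r $ last_ix"
proof -
  have "int (shift_period w r + w $ last_ix * r $ first_ix) = int (w $ first_ix * r $ last_ix)"
    using p_eq by simp
  then show ?thesis by (simp only: of_nat_eq_iff)
qed

lemma weight_r_shift_layer:
  "weight r (shift_layer a b)
    = (a + b) * (w $ last_ix * r $ first_ix) + a * shift_period w r"
proof -
  have "weight r (shift_layer a b)
      = b * (w $ last_ix * r $ first_ix) + a * (w $ first_ix * r $ last_ix)"
    by (simp add: weight_extremes algebra_simps)
  also have "\<dots> = b * (w $ last_ix * r $ first_ix)
      + a * (shift_period w r + w $ last_ix * r $ first_ix)"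
    by (simp only: period_nat_eq)
  finally show ?thesis by (simp add: algebra_simps)
qed

lemma kernel_shift_layer:
  assumes "weight w x = weight w z + a"
  shows "(x + shift_layer 0 (a + b), z + shift_layer a b) \<in> K (n + shift_period w r)
    \<longleftrightarrow> (x, z) \<in> K n"
  unfolding kernel_iff weight_add[of w _ "shift_layer _ _"] weight_add[of r _ "shift_layer _ _"]
    weight_shift_layer weight_r_shift_layer
  using assms by (simp add: algebra_simps)

text \<open>
  A layer for \<open>n + p\<close> that lies \<open>b\<close> above another one has \<open>high\<close> at least \<open>b w\<^sub>k (n + p)\<close>. The part
  \<open>b w\<^sub>k p\<close> is \<open>high\<close> of the compensation to be removed, and the part \<open>b w\<^sub>k n\<close> absorbs the inner
  generators, so for \<open>b > 0\<close> a concentrated representative contains more than \<open>b w\<^sub>k\<close> copies of the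
  first generator. The same holds for \<open>low\<close>, \<open>a\<close> and the last generator. Strictness of these estimates
  is what keeps \<open>i\<close> in the support even if it is the first or the last position.
\<close>

lemma unshift_layer:
  assumes "large n" and "(u, z) \<in> K (n + shift_period w r)" "(z, v) \<in> K (n + shift_period w r)"
    and "weight w u = weight w z + a" "weight w z = weight w v + b"
  obtains z0 where "bihom (z0 + shift_layer a b) z" "0 < z $ i \<longrightarrow> 0 < z0 $ i"
proof -
  obtain y where y: "bihom y z" "0 < z $ i \<longrightarrow> 0 < y $ i"
    "high z < p * int (y $ first_ix) + int n"
    "low z < p * int (y $ last_ix) + w1 * int n"
    by (rule concentrate[OF assms(1), of z i])
  \<comment> \<open>For \<open>b = 0\<close> nothing is removed at the first position, and a strict bound can fail.\<close>
  have first: "b * w $ last_ix < y $ first_ix" if "0 < b"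
  proof -
    have "int b * (wk * (int n + p)) \<le> int b * (rk + wk * (int n + p))"
      by (intro mult_left_mono) auto
    also have "\<dots> \<le> high z"
      using layer_gap(1)[OF assms(3,5)] high_nonneg[of v] by simp
    also note y(3)
    finally have "int b * wk * int n + p * (int b * wk) < p * int (y $ first_ix) + int n"
      by (simp add: algebra_simps)
    moreover have "1 * 1 * int n \<le> int b * wk * int n"
      using that wk_pos by (intro mult_mono) auto
    ultimately have "p * (int b * wk) < p * int (y $ first_ix)" by linarith
    then have "int (b * w $ last_ix) < int (y $ first_ix)"
      using period_pos by simp
    then show ?thesis by (simp only: of_nat_less_iff)
  qed
  have last: "a * w $ first_ix < y $ last_ix" if "0 < a"
  proof -
    have "int a * (w1 * (int n + p)) \<le> int a * (r1 + w1 * (int n + p))"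
      by (intro mult_left_mono) auto
    also have "\<dots> \<le> low z"
      using layer_gap(2)[OF assms(2,4)] low_nonneg[of u] by simp
    also note y(4)
    finally have "int a * (w1 * int n) + p * (int a * w1) < p * int (y $ last_ix) + w1 * int n"
      by (simp add: algebra_simps)
    moreover have "1 * (w1 * int n) \<le> int a * (w1 * int n)"
      using that by (intro mult_right_mono) auto
    ultimately have "p * (int a * w1) < p * int (y $ last_ix)" by linarith
    then have "int (a * w $ first_ix) < int (y $ last_ix)"
      using period_pos by simp
    then show ?thesis by (simp only: of_nat_less_iff)
  qed
  define z0 where "z0 = y - shift_layer a b"
  have "shift_layer a b $ j \<le> y $ j" for j
    unfolding extremes_nth using first last first_neq_last by (cases "a = 0"; cases "b = 0") auto
  then have "shift_layer a b \<le> y"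
    unfolding less_eq_vec_def by blast
  then have "y = z0 + shift_layer a b"
    unfolding z0_def by (rule vec_subtract_add)
  with y(1) have "bihom (z0 + shift_layer a b) z"
    by (simp only:)
  moreover have "0 < z $ i \<longrightarrow> 0 < z0 $ i"
  proof
    assume that: "0 < z $ i"
    have "shift_layer a b $ i < y $ i"
      unfolding extremes_nth using first last first_neq_last y(2) that by (cases "a = 0"; cases "b = 0") auto
    then show "0 < z0 $ i"
      unfolding z0_def vector_minus_component by simp
  qed
  ultimately show thesis by (rule that)
qed


section \<open>Betti pairs and connectedness of fibres\<close>

text \<open>
  For large \<open>m\<close> these are the pairs in the kernel, with the longer side first, whose sides lie in
  different layers and are not connected by common generators: their
  fibre consists of just the layers of \<open>x\<close> and \<open>y\<close> (\<open>betti_pair_two_layers\<close>), and these have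
  disjoint supports. Only layers in between are excluded explicitly, since this condition is easy to
  transport along the shift.
\<close>

definition betti_pair :: "nat \<Rightarrow> (nat, 'k) vec \<Rightarrow> (nat, 'k) vec \<Rightarrow> bool" where
  "betti_pair m x y \<longleftrightarrow> (x, y) \<in> K m \<and> weight w y < weight w x
    \<and> (\<forall>z. (x, z) \<in> K m \<longrightarrow> \<not> (weight w y < weight w z \<and> weight w z < weight w x))
    \<and> (\<forall>x' y'. bihom x' x \<longrightarrow> bihom y' y \<longrightarrow> \<not> share_generator x' y')"

lemma kernel_bihom_cong:
  assumes "bihom x x'" "bihom y y'"
  shows "(x, y) \<in> K m \<longleftrightarrow> (x', y') \<in> K m"
  using assms by (simp add: kernel_iff bihom_def)

lemma betti_pair_cong:
  assumes "bihom x x'" "bihom y y'" "betti_pair m x y"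
  shows "betti_pair m x' y'"
proof -
  have "bihom z x \<longleftrightarrow> bihom z x'" "bihom z y \<longleftrightarrow> bihom z y'" for z
    using assms(1,2) by (auto simp: bihom_def)
  moreover have "(x, z) \<in> K m \<longleftrightarrow> (x', z) \<in> K m" for z
    by (rule kernel_bihom_cong[OF assms(1) bihom_refl])
  moreover have "weight w x = weight w x'" "weight w y = weight w y'"
    using assms(1,2) by (auto simp: bihom_def)
  ultimately show ?thesis
    using assms(3) kernel_bihom_cong[OF assms(1,2), of m] unfolding betti_pair_def by metis
qed

lemma share_generator_add: "share_generator x y \<Longrightarrow> share_generator (x + u) (y + v)"
  by (auto simp: share_generator_def)

text \<open>
  Layers between the two sides, and generators shared by the two layers, are moved upwards by adding
  the compensations and downwards by \<open>unshift_layer\<close>.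
\<close>

lemma betti_pair_shift:
  assumes "large n" and l: "weight w x = weight w y + l"
  shows "betti_pair (n + shift_period w r) (x + shift_layer 0 l) (y + shift_layer l 0)
    \<longleftrightarrow> betti_pair n x y"
proof (cases "(x, y) \<in> K n \<and> 0 < l")
  case False
  then show ?thesis
    using kernel_shift_layer[OF l, of 0 n] l
    by (auto simp: betti_pair_def weight_add weight_shift_layer)
next
  case True
  define u v q where "u = x + shift_layer 0 l" and "v = y + shift_layer l 0"
    and "q = n + shift_period w r"
  have uv: "(u, v) \<in> K q"
    using True kernel_shift_layer[OF l, of 0 n] by (simp add: u_def v_def q_def)
  have wu: "weight w u = weight w x + l * (w $ first_ix * w $ last_ix)"
    unfolding u_def weight_add[of w x] weight_shift_layer by simp
  have wv: "weight w v = weight w y + l * (w $ first_ix * w $ last_ix)"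
    unfolding v_def weight_add[of w y] weight_shift_layer by simp
  have wuv: "weight w u = weight w v + l"
    using l wu wv by simp
  have "(\<exists>z. (x, z) \<in> K n \<and> weight w y < weight w z \<and> weight w z < weight w x) \<longleftrightarrow>
      (\<exists>z. (u, z) \<in> K q \<and> weight w v < weight w z \<and> weight w z < weight w u)" (is "?L \<longleftrightarrow> ?R")
  proof
    assume ?L
    then obtain z where z: "(x, z) \<in> K n" "weight w y < weight w z" "weight w z < weight w x"
      by blast
    define a b where "a = weight w x - weight w z" and "b = weight w z - weight w y"
    have ab: "a + b = l" "weight w x = weight w z + a"
      using z l by (auto simp: a_def b_def)
    have "(u, z + shift_layer a b) \<in> K q"
      using z(1) kernel_shift_layer[OF ab(2), of b n] ab(1) by (simp add: u_def q_def)
    moreover have "weight w (z + shift_layer a b) = weight w z + l * (w $ first_ix * w $ last_ix)"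
      unfolding weight_add[of w z] weight_shift_layer ab(1) ..
    ultimately show ?R using z(2,3) wu wv by (metis add_less_cancel_right)
  next
    assume ?R
    then obtain z where z: "(u, z) \<in> K q" "weight w v < weight w z" "weight w z < weight w u"
      by blast
    define a b where "a = weight w u - weight w z" and "b = weight w z - weight w v"
    have ab: "a + b = l" "weight w u = weight w z + a" "weight w z = weight w v + b"
      using z wuv by (auto simp: a_def b_def)
    have "(z, v) \<in> K q"
      using z(1) uv by (simp add: kernel_iff)
    then obtain z0 where z0: "bihom (z0 + shift_layer a b) z"
      using unshift_layer[OF assms(1), of u z v a b] z(1) ab unfolding q_def by metis
    then have "weight w z = weight w z0 + l * (w $ first_ix * w $ last_ix)"
      unfolding bihom_def weight_add[of w z0] weight_shift_layer ab(1) by simp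
    then have w0: "weight w y < weight w z0" "weight w z0 < weight w x" "weight w x = weight w z0 + a"
      using z wu wv ab by auto
    have "(u, z0 + shift_layer a b) \<in> K q"
      using kernel_bihom_cong[OF bihom_refl z0] z(1) by blast
    then have "(x, z0) \<in> K n"
      using kernel_shift_layer[OF w0(3), of b n] ab(1) by (simp add: u_def q_def)
    then show ?L using w0 by blast
  qed
  moreover have "(\<exists>x' y'. bihom x' x \<and> bihom y' y \<and> share_generator x' y') \<longleftrightarrow>
      (\<exists>x' y'. bihom x' u \<and> bihom y' v \<and> share_generator x' y')" (is "?L \<longleftrightarrow> ?R")
  proof
    assume ?L
    then obtain x' y' where "bihom x' x" "bihom y' y" "share_generator x' y'"
      by blast
    then have "bihom (x' + shift_layer 0 l) u" "bihom (y' + shift_layer l 0) v"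
      "share_generator (x' + shift_layer 0 l) (y' + shift_layer l 0)"
      unfolding u_def v_def bihom_add_right by (auto intro: share_generator_add)
    then show ?R by blast
  next
    assume ?R
    then obtain u' v' i where uv': "bihom u' u" "bihom v' v" and i: "0 < u' $ i" "0 < v' $ i"
      by (auto simp: share_generator_def)
    have uv'K: "(u', v') \<in> K q" "(u', u') \<in> K q" "(v', v') \<in> K q"
      using uv kernel_bihom_cong[OF uv'] by (auto simp: kernel_iff)
    have wuv': "weight w u' = weight w v' + l"
      using uv' wuv by (simp add: bihom_def)
    obtain x' where x': "bihom (x' + shift_layer 0 l) u'" "0 < x' $ i"
      using unshift_layer[OF assms(1), of u' u' v' 0 l i] uv'K wuv' i(1) unfolding q_def
      by (metis add_0_right)
    obtain y' where y': "bihom (y' + shift_layer l 0) v'" "0 < y' $ i"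
      using unshift_layer[OF assms(1), of u' v' v' l 0 i] uv'K wuv' i(2) unfolding q_def
      by (metis add_0_right)
    have "bihom x' x" "bihom y' y"
      using bihom_trans[OF x'(1) uv'(1)] bihom_trans[OF y'(1) uv'(2)]
      unfolding u_def v_def bihom_add_right by blast+
    then show ?L
      using x'(2) y'(2) by (auto simp: share_generator_def)
  qed
  ultimately show ?thesis
    using True uv wuv l unfolding betti_pair_def u_def[symmetric] v_def[symmetric] q_def[symmetric]
    by auto
qed

lemma betti_pair_unshift:
  assumes "large n" "betti_pair (n + shift_period w r) u v"
  obtains x y l where "betti_pair n x y" "weight w x = weight w y + l"
    "bihom (x + shift_layer 0 l) u" "bihom (y + shift_layer l 0) v"
proof -
  define q where "q = n + shift_period w r"
  define l where "l = weight w u - weight w v"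
  have uv: "(u, v) \<in> K q" "(u, u) \<in> K q" "(v, v) \<in> K q" and l: "weight w u = weight w v + l"
    using assms(2) by (auto simp: betti_pair_def q_def l_def kernel_iff)
  obtain x where x: "bihom (x + shift_layer 0 l) u"
    using unshift_layer[OF assms(1), of u u v 0 l] uv l unfolding q_def by (metis add_0_right)
  obtain y where y: "bihom (y + shift_layer l 0) v"
    using unshift_layer[OF assms(1), of u v v l 0] uv l unfolding q_def by (metis add_0_right)
  have wxy: "weight w x = weight w y + l"
    using x y l unfolding bihom_def weight_add[of w x] weight_add[of w y] weight_shift_layer
    by simp
  have "betti_pair n x y"
    using betti_pair_cong[OF bihom_sym[OF x] bihom_sym[OF y] assms(2)]
      betti_pair_shift[OF assms(1) wxy] by blast
  then show thesis using wxy x y by (rule that)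
qed

text \<open>
  If there were a longer layer, then the layers of \<open>x\<close> and \<open>y\<close> would both reach the last
  generator; if there were a shorter one, they would both reach the first.
\<close>

lemma betti_pair_two_layers:
  assumes "large m" "betti_pair m x y" "(x, z) \<in> K m"
  shows "bihom z x \<or> bihom z y"
proof -
  have xy: "(x, y) \<in> K m" "weight w y < weight w x"
    and disjoint: "\<And>x' y'. bihom x' x \<Longrightarrow> bihom y' y \<Longrightarrow> \<not> share_generator x' y'"
    and no_middle: "\<not> (weight w y < weight w z \<and> weight w z < weight w x)"
    using assms(2,3) by (auto simp: betti_pair_def)
  have zxy: "(z, x) \<in> K m" "(z, y) \<in> K m" "(y, z) \<in> K m"
    using xy assms(3) by (auto simp: kernel_iff)
  have "\<not> weight w x < weight w z"
  proof
    assume longer: "weight w x < weight w z"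
    obtain x' where "bihom x' x" "0 < x' $ last_ix"
      using short_reaches_last[OF assms(1) zxy(1) longer] by metis
    moreover obtain y' where "bihom y' y" "0 < y' $ last_ix"
      using short_reaches_last[OF assms(1) xy] by metis
    ultimately show False using disjoint by (meson share_generator_def)
  qed
  moreover have "\<not> weight w z < weight w y"
  proof
    assume shorter: "weight w z < weight w y"
    obtain x' where "bihom x' x" "0 < x' $ first_ix"
      using long_reaches_first[OF assms(1) xy] by metis
    moreover obtain y' where "bihom y' y" "0 < y' $ first_ix"
      using long_reaches_first[OF assms(1) zxy(3) shorter] by metis
    ultimately show False using disjoint by (meson share_generator_def)
  qed
  ultimately have "weight w z = weight w x \<or> weight w z = weight w y"
    using no_middle by linarith
  then show ?thesis using zxy by (auto simp: bihom_iff_kernel[of _ _ m])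
qed

definition homogeneous_steps :: "(nat, 'k) vec rel \<Rightarrow> (nat, 'k) vec rel" where
  "homogeneous_steps S = {(x, y). bihom x y \<and> (share_generator x y \<or> (x, y) \<in> S)}"

lemma weight_zero_iff: "weight w x = 0 \<longleftrightarrow> x = 0"
proof -
  have "w $ i \<noteq> 0" for i
    using w_pos[of i] by linarith
  then show ?thesis by (simp add: weight_def vec_eq_iff del: neq0_conv)
qed

text \<open>
  If the fibre has another layer, then both elements can be moved, along shared generators and
  within their layer, to elements containing the same extreme generator. Otherwise the given path
  cannot leave the layer.
\<close>

lemma homogeneous_connected:
  assumes "large m" "S \<subseteq> K m" and conn: "K m \<subseteq> (sharing_pairs (shifted_gens w r m) \<union> S)\<^sup>*"
    and xy: "bihom x y"
  shows "(x, y) \<in> (homogeneous_steps S)\<^sup>*"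
proof (cases "\<exists>z. (x, z) \<in> K m \<and> weight w z \<noteq> weight w x")
  case True
  then obtain z where z: "(x, z) \<in> K m" "weight w z \<noteq> weight w x" by blast
  then have x: "(x, z) \<in> K m" "(z, x) \<in> K m" and y: "(y, z) \<in> K m" "(z, y) \<in> K m"
    using xy by (auto simp: kernel_iff bihom_def)
  have wxy: "weight w x = weight w y"
    using xy by (simp add: bihom_def)
  show ?thesis
  proof (cases "x = 0")
    case True
    then have "y = 0" using wxy weight_zero_iff by metis
    with True show ?thesis by simp
  next
    case False
    then have "y \<noteq> 0" using wxy weight_zero_iff by metis
    with False obtain i j where i: "0 < x $ i" and j: "0 < y $ j"
      by (auto simp: vec_eq_iff)
    have "\<exists>x' y' e. bihom x' x \<and> bihom y' y \<and> 0 < x' $ i \<and> 0 < y' $ j \<and> 0 < x' $ e \<and> 0 < y' $ e"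
    proof (cases "weight w z < weight w x")
      case True
      obtain x' where "bihom x' x" "0 < x' $ first_ix" "0 < x' $ i"
        using long_reaches_first[OF assms(1) x(1) True] i by metis
      moreover obtain y' where "bihom y' y" "0 < y' $ first_ix" "0 < y' $ j"
        using long_reaches_first[OF assms(1) y(1)] True wxy j by metis
      ultimately show ?thesis by blast
    next
      case False
      then have less: "weight w x < weight w z" using z(2) by simp
      obtain x' where "bihom x' x" "0 < x' $ last_ix" "0 < x' $ i"
        using short_reaches_last[OF assms(1) x(2) less] i by metis
      moreover obtain y' where "bihom y' y" "0 < y' $ last_ix" "0 < y' $ j"
        using short_reaches_last[OF assms(1) y(2)] less wxy j by metis
      ultimately show ?thesis by blast
    qed
    then obtain x' y' e where *: "bihom x' x" "bihom y' y" "0 < x' $ i" "0 < y' $ j"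
      "0 < x' $ e" "0 < y' $ e" by blast
    have "(x, x') \<in> homogeneous_steps S" "(x', y') \<in> homogeneous_steps S"
      "(y', y) \<in> homogeneous_steps S"
      using * i j xy by (auto simp: homogeneous_steps_def share_generator_def bihom_def)
    then show ?thesis by (meson converse_rtrancl_into_rtrancl r_into_rtrancl)
  qed
next
  case False
  have "(x, y) \<in> (sharing_pairs (shifted_gens w r m) \<union> S)\<^sup>*"
    using conn xy bihom_iff_kernel by blast
  then have "(x, y) \<in> (homogeneous_steps S)\<^sup>* \<and> bihom x y"
  proof (induction rule: rtrancl_induct)
    case base
    show ?case by (simp add: bihom_refl)
  next
    case (step u v)
    have uv: "(u, v) \<in> K m"
      using step.hyps(2) assms(2) by (auto simp: sharing_pairs_def)
    then have "(x, v) \<in> K m"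
      using step.IH by (auto simp: kernel_iff bihom_def)
    then have xv: "bihom x v"
      using False bihom_iff_kernel by metis
    then have "bihom u v"
      using step.IH by (simp add: bihom_def)
    then have "(u, v) \<in> homogeneous_steps S"
      using step.hyps(2) by (auto simp: homogeneous_steps_def sharing_pairs_def)
    then show ?case using step.IH xv by (auto intro: rtrancl_into_rtrancl)
  qed
  then show ?thesis by blast
qed

text \<open>
  The fibre of a betti pair has only the two layers, so a path between them must cross directly from
  one to the other, and it cannot do so along a shared generator.
\<close>

lemma betti_pair_bridged:
  assumes "large m" "S \<subseteq> K m" and conn: "K m \<subseteq> (sharing_pairs (shifted_gens w r m) \<union> S)\<^sup>*"
    and betti: "betti_pair m x y"
  shows "\<exists>(u, v)\<in>S. bihom u x \<and> bihom v y"
proof (rule ccontr)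
  assume no_bridge: "\<not> ?thesis"
  have "(x, y) \<in> K m"
    using betti by (simp add: betti_pair_def)
  then have "(x, y) \<in> (sharing_pairs (shifted_gens w r m) \<union> S)\<^sup>*"
    using conn by blast
  then have "bihom y x"
  proof (induction rule: rtrancl_induct)
    case base
    show ?case by (rule bihom_refl)
  next
    case (step u v)
    have "(u, v) \<in> K m"
      using step.hyps(2) assms(2) by (auto simp: sharing_pairs_def)
    then have "(x, v) \<in> K m"
      using step.IH by (auto simp: kernel_iff bihom_def)
    then consider "bihom v x" | "bihom v y"
      using betti_pair_two_layers[OF assms(1) betti] by blast
    then show ?case
    proof cases
      case 2
      then have "\<not> share_generator u v"
        using betti step.IH by (auto simp: betti_pair_def)
      then have "(u, v) \<in> S"
        using step.hyps(2) by (auto simp: sharing_pairs_def)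
      then show ?thesis using no_bridge step.IH 2 by blast
    qed
  qed
  then show False
    using betti by (simp add: betti_pair_def bihom_def)
qed

text \<open>
  Induction on the difference of the weights: unless the pair is a betti pair, it can be split at
  a layer in between or connected through a shared generator.
\<close>

lemma connected_if_layers_connected:
  assumes "sym S"
    and hom: "\<And>x y. bihom x y \<Longrightarrow> (x, y) \<in> (homogeneous_steps S)\<^sup>*"
    and bridge: "\<And>x y. betti_pair m x y \<Longrightarrow> \<exists>(u, v)\<in>S. bihom u x \<and> bihom v y"
  shows "K m \<subseteq> (sharing_pairs (shifted_gens w r m) \<union> S)\<^sup>*"
proof -
  define T where "T = sharing_pairs (shifted_gens w r m) \<union> S"
  have "sym T"
    using assms(1) unfolding T_def
    by (intro sym_Un) (auto simp: sym_def sharing_pairs_def kernel_iff share_generator_sym)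
  have "homogeneous_steps S \<subseteq> T"
    by (auto simp: homogeneous_steps_def T_def sharing_pairs_def kernel_iff bihom_def)
  then have hom': "(x, y) \<in> T\<^sup>*" if "bihom x y" for x y
    using hom[OF that] rtrancl_mono by blast
  have longer: "(x, y) \<in> T\<^sup>*" if "(x, y) \<in> K m" "weight w y < weight w x" for x y
    using that
  proof (induction "weight w x - weight w y" arbitrary: x y rule: less_induct)
    case less
    show ?case
    proof (cases "betti_pair m x y")
      case True
      then obtain u v where "(u, v) \<in> S" "bihom u x" "bihom v y"
        using bridge by blast
      then have "(x, u) \<in> T\<^sup>*" "(u, v) \<in> T" "(v, y) \<in> T\<^sup>*"
        by (auto simp: T_def intro: hom'[unfolded T_def] bihom_sym)
      then show ?thesis by (meson rtrancl_into_rtrancl rtrancl_trans)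
    next
      case False
      then consider
        (middle) z where "(x, z) \<in> K m" "weight w y < weight w z" "weight w z < weight w x" |
        (sharing) x' y' where "bihom x' x" "bihom y' y" "share_generator x' y'"
        using less.prems unfolding betti_pair_def by blast
      then show ?thesis
      proof cases
        case middle
        then have "(z, y) \<in> K m"
          using less.prems(1) by (simp add: kernel_iff)
        with middle less have "(x, z) \<in> T\<^sup>*" "(z, y) \<in> T\<^sup>*"
          by simp_all
        then show ?thesis by (rule rtrancl_trans)
      next
        case sharing
        have "(x', y') \<in> K m"
          using less.prems(1) kernel_bihom_cong[OF sharing(1,2)] by blast
        then have "(x', y') \<in> T"
          using sharing(3) by (simp add: T_def sharing_pairs_def)
        moreover have "(x, x') \<in> T\<^sup>*" "(y', y) \<in> T\<^sup>*"
          using sharing by (auto intro: hom' bihom_sym)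
        ultimately show ?thesis by (meson rtrancl_into_rtrancl rtrancl_trans)
      qed
    qed
  qed
  have "(x, y) \<in> T\<^sup>*" if "(x, y) \<in> K m" for x y
  proof (cases "weight w x" "weight w y" rule: linorder_cases)
    case less
    then have "(y, x) \<in> T\<^sup>*"
      using longer that by (simp add: kernel_iff)
    then show ?thesis using sym_rtrancl[OF \<open>sym T\<close>] by (rule symD[rotated])
  next
    case equal
    then show ?thesis using that hom' bihom_iff_kernel by blast
  next
    case greater
    then show ?thesis using longer that by blast
  qed
  then show ?thesis by (auto simp: T_def)
qed

lemma connected_iff_layers:
  assumes "large m" "S \<subseteq> K m" "sym S"
  shows "K m \<subseteq> (sharing_pairs (shifted_gens w r m) \<union> S)\<^sup>* \<longleftrightarrow>
    (\<forall>x y. bihom x y \<longrightarrow> (x, y) \<in> (homogeneous_steps S)\<^sup>*) \<and>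
    (\<forall>x y. betti_pair m x y \<longrightarrow> (\<exists>(u, v)\<in>S. bihom u x \<and> bihom v y))"
  using homogeneous_connected[OF assms(1,2)] betti_pair_bridged[OF assms(1,2)]
    connected_if_layers_connected[OF assms(3)] by blast


section \<open>Transport along the shift\<close>

lemma Phi_longer:
  assumes "weight w x = weight w y + l" "0 < l"
  shows "Phi w (x, y) = (x + shift_layer 0 l, y + shift_layer l 0)"
  using assms by (simp add: Phi_def Let_def extremes_def)

lemma Phi_swap: "Phi w (prod.swap z) = prod.swap (Phi w z)"
  by (cases z) (auto simp: Phi_def Let_def nat_minus_as_int abs_minus_commute)

lemma Phi_weight_diff:
  assumes "Phi w (x, y) = (u, v)"
  shows "int (weight w u) - int (weight w v) = int (weight w x) - int (weight w y)"
proof -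
  have longer: "int (weight w u) - int (weight w v) = int (weight w x) - int (weight w y)"
    if "Phi w (x, y) = (u, v)" "weight w y < weight w x" for x y u v
  proof -
    obtain l where l: "weight w x = weight w y + l" "0 < l"
      using \<open>weight w y < weight w x\<close> by (metis less_imp_add_positive)
    show ?thesis
      using Phi_longer[OF l] that(1) by (auto simp: weight_add weight_extremes)
  qed
  show ?thesis
  proof (cases "weight w x" "weight w y" rule: linorder_cases)
    case less
    then show ?thesis
      using longer[of y x v u] Phi_swap[of "(x, y)"] assms by simp
  next
    case equal
    then show ?thesis using assms by (simp add: Phi_def)
  next
    case greater
    then show ?thesis using longer assms by blast
  qed
qed

text \<open>
  Connectivity depends only on the symmetric closure of a set of relations, and \<open>Phi\<close> is
  compatible with it.
\<close>

lemma Phi_image_symcl: "Phi w ` (\<sigma> \<union> \<sigma>\<inverse>) = Phi w ` \<sigma> \<union> (Phi w ` \<sigma>)\<inverse>"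
proof -
  have conv: "A\<inverse> = prod.swap ` A" for A :: "(nat, 'k) vec rel"
    by force
  show ?thesis
    unfolding conv image_Un image_image Phi_swap ..
qed

lemma homogeneous_steps_Phi:
  assumes "S \<subseteq> K n"
  shows "homogeneous_steps (Phi w ` S) = homogeneous_steps S"
proof -
  have fixed: "Phi w (x, y) = (x, y)" if "bihom x y" for x y
    using that by (simp add: Phi_def bihom_def)
  have "bihom x y" if "bihom u v" "(u, v) = Phi w (x, y)" "(x, y) \<in> S" for u v x y
  proof (rule ccontr)
    assume "\<not> bihom x y"
    moreover have "(x, y) \<in> K n" using that(3) assms by blast
    ultimately have "weight w x \<noteq> weight w y"
      using bihom_iff_kernel by blast
    then show False
      using Phi_weight_diff[OF that(2)[symmetric]] that(1) by (simp add: bihom_def)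
  qed
  then have "(u, v) \<in> Phi w ` S \<longleftrightarrow> (u, v) \<in> S" if "bihom u v" for u v
    using that fixed by (smt (verit, best) image_iff surj_pair)
  then show ?thesis by (auto simp: homogeneous_steps_def)
qed

lemma betti_pairs_bridged_Phi:
  assumes "large n" and S: "S \<subseteq> K n"
  shows "(\<forall>u v. betti_pair (n + shift_period w r) u v \<longrightarrow>
      (\<exists>(s, t)\<in>Phi w ` S. bihom s u \<and> bihom t v)) \<longleftrightarrow>
    (\<forall>x y. betti_pair n x y \<longrightarrow> (\<exists>(s, t)\<in>S. bihom s x \<and> bihom t y))" (is "?L \<longleftrightarrow> ?R")
proof
  assume ?R
  show ?L
  proof (intro allI impI)
    fix u v
    assume "betti_pair (n + shift_period w r) u v"
    then obtain x y l where xy: "betti_pair n x y" "weight w x = weight w y + l"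
      "bihom (x + shift_layer 0 l) u" "bihom (y + shift_layer l 0) v"
      using betti_pair_unshift[OF assms(1)] by metis
    then obtain s t where st: "(s, t) \<in> S" "bihom s x" "bihom t y"
      using \<open>?R\<close> by blast
    have "0 < l" using xy by (simp add: betti_pair_def)
    moreover have "weight w s = weight w t + l"
      using st xy(2) by (simp add: bihom_def)
    ultimately have "Phi w (s, t) = (s + shift_layer 0 l, t + shift_layer l 0)"
      by (intro Phi_longer)
    moreover have "bihom (s + shift_layer 0 l) u" "bihom (t + shift_layer l 0) v"
      using st xy bihom_add_right bihom_trans by blast+
    ultimately show "\<exists>(s, t)\<in>Phi w ` S. bihom s u \<and> bihom t v"
      using st(1) by force
  qed
next
  assume ?L
  show ?R
  proof (intro allI impI)
    fix x y
    assume betti: "betti_pair n x y"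
    then obtain l where l: "weight w x = weight w y + l" "0 < l"
      by (metis betti_pair_def less_imp_add_positive)
    define u v where "u = x + shift_layer 0 l" and "v = y + shift_layer l 0"
    have wuv: "weight w u = weight w v + l"
      using l(1) unfolding u_def v_def weight_add[of w x] weight_add[of w y] weight_shift_layer by simp
    have "betti_pair (n + shift_period w r) u v"
      using betti betti_pair_shift[OF assms(1) l(1)] by (simp add: u_def v_def)
    then obtain s t s' t' where st: "(s, t) \<in> S" "Phi w (s, t) = (s', t')" "bihom s' u" "bihom t' v"
      using \<open>?L\<close> by (smt (verit) case_prodE imageE surj_pair)
    have wst': "weight w s' = weight w t' + l"
      using st(3,4) wuv by (simp add: bihom_def)
    have "weight w s = weight w t + l"
      using Phi_weight_diff[OF st(2)] wst' by linarith
    then have "Phi w (s, t) = (s + shift_layer 0 l, t + shift_layer l 0)"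
      using l(2) by (rule Phi_longer)
    then have "bihom s x" "bihom t y"
      using st(2-4) unfolding u_def v_def by (metis bihom_add_right prod.inject)+
    then show "\<exists>(s, t)\<in>S. bihom s x \<and> bihom t y"
      using st(1) by blast
  qed
qed

lemma presentation_Phi_iff:
  assumes "large n" "\<sigma> \<subseteq> K n"
  shows "is_presentation (shifted_gens w r (n + shift_period w r)) (Phi w ` \<sigma>)
    \<longleftrightarrow> is_presentation (shifted_gens w r n) \<sigma>"
proof -
  define S where "S = \<sigma> \<union> \<sigma>\<inverse>"
  have S: "S \<subseteq> K n" "sym S"
    using assms(2) by (auto simp: S_def kernel_iff sym_Un_converse)
  have image: "Phi w ` A \<subseteq> K (n + shift_period w r)" if "A \<subseteq> K n" for A
  proof (rule image_subsetI)
    fix z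
    assume "z \<in> A"
    then have "(fst z, snd z) \<in> K n"
      using that by auto
    moreover have "\<forall>i. 1 \<le> w $ i"
      "\<forall>i j. i \<le> j \<longrightarrow> real (r $ i) / real (w $ i) \<le> real (r $ j) / real (w $ j)"
      using w_pos slopes by blast+
    ultimately show "Phi w z \<in> K (n + shift_period w r)"
      using Phi_in_factorization_kernel by (metis prod.collapse)
  qed
  have S': "Phi w ` S = Phi w ` \<sigma> \<union> (Phi w ` \<sigma>)\<inverse>"
    unfolding S_def by (rule Phi_image_symcl)
  have large': "large (n + shift_period w r)"
    using assms(1) by (simp add: large_def)
  have pos: "\<forall>i. 0 < shifted_gens w r m $ i" if "large m" for m
    using that w_pos by (auto simp: shifted_gens_def large_def Suc_le_eq)
  have "is_presentation (shifted_gens w r (n + shift_period w r)) (Phi w ` \<sigma>) \<longleftrightarrow>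
      K (n + shift_period w r) \<subseteq> (sharing_pairs (shifted_gens w r (n + shift_period w r)) \<union> Phi w ` S)\<^sup>*"
    unfolding S' by (rule is_presentation_iff_connected[OF pos[OF large'] image[OF assms(2)]])
  also have "\<dots> \<longleftrightarrow> K n \<subseteq> (sharing_pairs (shifted_gens w r n) \<union> S)\<^sup>*"
    unfolding connected_iff_layers[OF assms(1) S]
    by (subst connected_iff_layers[OF large' image[OF S(1)]])
      (simp_all add: S' sym_Un_converse homogeneous_steps_Phi[OF S(1), unfolded S']
        betti_pairs_bridged_Phi[OF assms(1) S(1), unfolded S'])
  also have "\<dots> \<longleftrightarrow> is_presentation (shifted_gens w r n) \<sigma>"
    unfolding S_def by (rule is_presentation_iff_connected[OF pos[OF assms(1)] assms(2), symmetric])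
  finally show ?thesis .
qed

lemma minimal_presentation_Phi:
  assumes "large n" and min: "is_minimal_presentation (shifted_gens w r n) \<rho>"
  shows "is_minimal_presentation (shifted_gens w r (n + shift_period w r)) (Phi w ` \<rho>)"
  unfolding is_minimal_presentation_def
proof (intro conjI allI impI)
  have pres: "is_presentation (shifted_gens w r n) \<rho>"
    and least: "\<And>\<sigma>. is_presentation (shifted_gens w r n) \<sigma> \<Longrightarrow> \<sigma> \<subseteq> \<rho> \<Longrightarrow> \<sigma> = \<rho>"
    using min by (auto simp: is_minimal_presentation_def)
  then have \<rho>: "\<rho> \<subseteq> K n"
    by (simp add: is_presentation_def)
  show "is_presentation (shifted_gens w r (n + shift_period w r)) (Phi w ` \<rho>)"
    using presentation_Phi_iff[OF assms(1) \<rho>] pres by blast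
  fix \<tau>
  assume \<tau>: "is_presentation (shifted_gens w r (n + shift_period w r)) \<tau> \<and> \<tau> \<subseteq> Phi w ` \<rho>"
  then obtain \<sigma> where \<sigma>: "\<sigma> \<subseteq> \<rho>" "\<tau> = Phi w ` \<sigma>"
    by (auto simp: subset_image_iff)
  then have "is_presentation (shifted_gens w r n) \<sigma>"
    using presentation_Phi_iff[OF assms(1)] \<tau> \<rho> by blast
  then show "\<tau> = Phi w ` \<rho>"
    using least \<sigma> by blast
qed

end

text \<open>
  If \<open>p = 0\<close> then the slopes at both ends agree, hence all slopes equal some \<open>s\<close>, and the value of
  a factorization is \<open>(n + s) |z|\<^sub>w\<close>.
\<close>

lemma kernel_homogeneous_if_period_zero:
  fixes w r :: "nat ^ 'k::{finite,linorder}"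
  assumes w_pos: "\<forall>i. 1 \<le> w $ i"
    and slopes: "\<forall>i j. i \<le> j \<longrightarrow> real (r $ i) / real (w $ i) \<le> real (r $ j) / real (w $ j)"
    and "shift_period w r = 0" "0 < n"
    and xy: "(x, y) \<in> factorization_kernel (shifted_gens w r n)"
  shows "weight w x = weight w y"
proof -
  define s where "s = real (r $ first_ix) / real (w $ first_ix)"
  have pos: "0 < real (w $ i)" for i
    using w_pos[rule_format, of i] by simp
  have "int (w $ first_ix) * int (r $ last_ix) = int (w $ last_ix) * int (r $ first_ix)"
    using int_shift_period[OF w_pos slopes] assms(3) by simp
  then have "real (w $ first_ix) * real (r $ last_ix) = real (w $ last_ix) * real (r $ first_ix)"
    by (metis of_nat_eq_iff of_nat_mult)
  then have "real (r $ last_ix) / real (w $ last_ix) = s"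
    using pos[of first_ix] pos[of last_ix] by (simp add: s_def field_simps)
  then have "real (r $ i) / real (w $ i) = s" for i
    using slopes[rule_format, of first_ix i] slopes[rule_format, of i last_ix]
    by (simp add: s_def first_ix_def last_ix_def)
  then have r: "real (r $ i) = s * real (w $ i)" for i
    using pos[of i] by (metis nonzero_divide_eq_eq order_less_irrefl)
  have "real (weight r z) = s * real (weight w z)" for z
    by (simp add: weight_def r sum_distrib_left mult.assoc)
  then have "(real n + s) * real (weight w x) = (real n + s) * real (weight w y)"
    using xy unfolding factorization_kernel_def factorization_hom_shifted_gens_eq
    by (simp add: distrib_right) (metis of_nat_add of_nat_mult)
  moreover have "0 < real n + s"
    using \<open>0 < n\<close> by (simp add: s_def add_pos_nonneg)
  ultimately show ?thesis by simp
qed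

theorem theorem5p8:
  fixes w r :: "nat ^ 'k::{finite,linorder}" and n :: nat and \<rho> :: "(nat ^ 'k::{finite,linorder}) rel"
  assumes "\<forall>i. 1 \<le> w $ i"
    and "\<forall>i j. i \<le> j \<longrightarrow> real (r $ i) / real (w $ i) \<le> real (r $ j) / real (w $ j)"
    and "r $ first_ix < w $ first_ix"
    and "n > (w $ first_ix)\<^sup>2 * Max (range (($) w)) * (Max (range (($) r)))\<^sup>2"
    and "is_minimal_presentation (shifted_gens w r n) \<rho>"
  shows "is_minimal_presentation (shifted_gens w r (n + shift_period w r)) (Phi w ` \<rho>)"
proof (cases "shift_period w r = 0")
  case True
  have "Phi w (x, y) = (x, y)" if "(x, y) \<in> \<rho>" for x y
  proof -
    have "(x, y) \<in> factorization_kernel (shifted_gens w r n)"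
      using assms(5) that by (auto simp: is_minimal_presentation_def is_presentation_def)
    moreover have "0 < n"
      using assms(4) by linarith
    ultimately have "weight w x = weight w y"
      by (intro kernel_homogeneous_if_period_zero[OF assms(1,2) True])
    then show ?thesis by (simp add: Phi_def)
  qed
  then have "Phi w ` \<rho> = \<rho>"
    by force
  then show ?thesis using assms(5) True by simp
next
  case False
  interpret shifted_family w r
    using assms(1,2) False by unfold_locales auto
  show ?thesis
    using assms(4,5) by (intro minimal_presentation_Phi) (simp_all add: large_def)
qed

end
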